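(* In the spiked model with projections $\Omega_1,\dots,\Omega_I$ and $\Pi_1,\dots,\Pi_J$ described in the context, the localized denoiser $\widehat{\mathbf X}^{\mathrm{loc}}$ and the optimal singular value shrinker $\widehat{\mathbf X}^{\mathrm{shr}}$ satisfy $\|\widehat{\mathbf X}^{\mathrm{loc}}-\mathbf X\|_{\mathrm F}^2\le\|\widehat{\mathbf X}^{\mathrm{shr}}-\mathbf X\|_{\mathrm F}^2$ almost surely as $p,n\to\infty$; that is, almost surely, $$\lim_{n\to\infty}\|\widehat{\mathbf X}^{\mathrm{loc}}-\mathbf X\|_{\mathrm F}^2\le\lim_{n\to\infty}\|\widehat{\mathbf X}^{\mathrm{shr}}-\mathbf X\|_{\mathrm F}^2 .$$
   Context: Model. For each $n$ let $p=p_n$, with $p\to\infty$ and $p_n/n\to\gamma$ as $n\to\infty$, where $\gamma$ is well-defined and finite. All vectors and matrices below are sequences indexed by $n$ (or $p$); this index is suppressed. We observe $\mathbf Y=\mathbf X+\mathbf G\in\mathbb R^{p\times n}$, where $\mathbf G$ has iid $N(0,1/n)$ entries and $\mathbf X=\sum_{k=1}^r t_k\mathbf u_k\mathbf v_k^T$; $r$ and $t_1>\dots>t_r>0$ are fixed (independent of $n$), $\mathbf u_1,\dots,\mathbf u_r\in\mathbb R^p$ are orthonormal and $\mathbf v_1,\dots,\mathbf v_r\in\mathbb R^n$ are orthonormal (deterministic, or random and independent of $\mathbf G$). $\hat{\mathbf u}_k,\hat{\mathbf v}_k$ are the left and right singular vectors of $\mathbf Y$ for its $k$-th largest singular value; $\widehat{\mathbf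 U}=[\hat{\mathbf u}_1,\dots,\hat{\mathbf u}_r]$, $\widehat{\mathbf V}=[\hat{\mathbf v}_1,\dots,\hat{\mathbf v}_r]$. Signs of the empirical singular vector pairs are chosen so that the almost sure limits of $\langle\hat{\mathbf u}_k,\mathbf u_k\rangle$ and $\langle\hat{\mathbf v}_k,\mathbf v_k\rangle$ are nonnegative (known to be possible); these limits are $c_k=\sqrt{\frac{1-\gamma/t_k^4}{1+\gamma/t_k^2}}$, $\tilde c_k=\sqrt{\frac{1-\gamma/t_k^4}{1+1/t_k^2}}$ if $t_k>\gamma^{1/4}$ and $c_k=\tilde c_k=0$ otherwise. Projections. $I,J$ are fixed. $\Omega_1,\dots,\Omega_I\in\mathbb R^{p\times p}$ and $\Pi_1,\dots,\Pi_J\in\mathbb R^{n\times n}$ are (deterministic) pairwise orthogonal orthogonal projections: $\Omega_i=\Omega_i^T=\Omega_i^2$, $\Omega_{i'}\Omega_i=0$ for $i\ne i'$, $\sum_i\Omega_i=\mathbf I_p$, and similarly for the $\Pi_j$ with $\sum_j\Pi_j=\mathbf I_n$. For all $i,j$ and $1\le k,l\le r$ the following limits are assumed to exist (almost surely) and be finite: $\lim\frac1p\mathrm{tr}(\Omega_i)$, $\lim\frac1n\mathrm{tr}(\Pi_j)$, $\lim\langle\Omega_i\mathbf u_k,\Omega_i\mathbf u_l\rangle$, $\lim\langle\Pi_j\mathbf v_k,\Pi_j\mathbf v_l\rangle$, with the first two, and the last two for $k=l$, positive. Denoisers. For weights $(\Omega_i,\Pi_j)$, the optimal spectral denoiser is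 $\widehat{\mathbf X}^{\mathrm{loc}}_{(i,j)}=\widehat{\mathbf U}\widehat{\mathbf B}_{(i,j)}\widehat{\mathbf V}^T$, where $\widehat{\mathbf B}_{(i,j)}$ minimizes over deterministic $\mathbf B\in\mathbb R^{r\times r}$ the asymptotic weighted loss $\lim_{n\to\infty}\|\Omega_i(\widehat{\mathbf U}\mathbf B\widehat{\mathbf V}^T-\mathbf X)\Pi_j^T\|_{\mathrm F}^2$ (an almost sure limit). The locally-denoised matrix is $\widehat{\mathbf X}^{\mathrm{loc}}=\sum_{i=1}^I\sum_{j=1}^J\Omega_i\widehat{\mathbf X}^{\mathrm{loc}}_{(i,j)}\Pi_j$. The optimal singular value shrinker is $\widehat{\mathbf X}^{\mathrm{shr}}=\sum_{k=1}^rt_kc_k\tilde c_k\hat{\mathbf u}_k\hat{\mathbf v}_k^T$. *)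

theory Defs
  imports "HOL-Probability.Probability" "Jordan_Normal_Form.Matrix"
begin

unbundle no vec_syntax

text \<open>
  Matrices of varying size are elements of \<^typ>\<open>real mat\<close>.  All indices start at \<open>0\<close>: the spike
  \<open>k\<close> of the mathematical text is the spike \<open>k - 1\<close> here, and likewise for the projections.
\<close>

definition frob_sq :: "real mat \<Rightarrow> real" where
  "frob_sq A = (\<Sum>a<dim_row A. \<Sum>b<dim_col A. (A $$ (a, b))\<^sup>2)"

definition mat_trace :: "real mat \<Rightarrow> real" where
  "mat_trace A = (\<Sum>a<dim_row A. A $$ (a, a))"

definition mat_sum :: "nat \<Rightarrow> nat \<Rightarrow> ('i \<Rightarrow> real mat) \<Rightarrow> 'i set \<Rightarrow> real mat" where
  "mat_sum nr nc A K = mat nr nc (\<lambda>(a, b). \<Sum>i\<in>K. A i $$ (a, b))"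

text \<open>The matrix \<open>\<Sum>k<m. s k \<cdot> x k \<cdot> (y k)\<^sup>T\<close>.\<close>

definition rank_one_sum ::
    "nat \<Rightarrow> nat \<Rightarrow> nat \<Rightarrow> (nat \<Rightarrow> real) \<Rightarrow> (nat \<Rightarrow> real vec) \<Rightarrow> (nat \<Rightarrow> real vec) \<Rightarrow> real mat" where
  "rank_one_sum nr nc m s x y = mat nr nc (\<lambda>(a, b). \<Sum>k<m. s k * x k $ a * y k $ b)"

definition orthonormal_family :: "nat \<Rightarrow> nat \<Rightarrow> (nat \<Rightarrow> real vec) \<Rightarrow> bool" where
  "orthonormal_family d m x \<longleftrightarrow>
     (\<forall>k<m. x k \<in> carrier_vec d) \<and>
     (\<forall>k<m. \<forall>l<m. scalar_prod (x k) (x l) = (if k = l then 1 else 0))"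

text \<open>
  A singular value decomposition with the singular values in decreasing order, so that \<open>x k\<close> and
  \<open>y k\<close> are left and right singular vectors for the \<open>(k + 1)\<close>-th largest singular value \<open>s k\<close>,
  counted with multiplicity.
\<close>

definition is_svd ::
    "real mat \<Rightarrow> (nat \<Rightarrow> real) \<Rightarrow> (nat \<Rightarrow> real vec) \<Rightarrow> (nat \<Rightarrow> real vec) \<Rightarrow> bool" where
  "is_svd A s x y \<longleftrightarrow>
     (let m = min (dim_row A) (dim_col A) in
        orthonormal_family (dim_row A) m x \<and>
        orthonormal_family (dim_col A) m y \<and>
        (\<forall>k<m. 0 \<le> s k) \<and>
        (\<forall>k l. k \<le> l \<longrightarrow> l < m \<longrightarrow> s l \<le> s k) \<and>
        A = rank_one_sum (dim_row A) (dim_col A) m s x y)"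

definition cos_left :: "real \<Rightarrow> real \<Rightarrow> real" where
  "cos_left \<gamma> s = (if s > root 4 \<gamma> then sqrt ((1 - \<gamma> / s ^ 4) / (1 + \<gamma> / s\<^sup>2)) else 0)"

definition cos_right :: "real \<Rightarrow> real \<Rightarrow> real" where
  "cos_right \<gamma> s = (if s > root 4 \<gamma> then sqrt ((1 - \<gamma> / s ^ 4) / (1 + 1 / s\<^sup>2)) else 0)"

text \<open>
  At index \<open>n\<close> the observation is \<open>X + G\<close> with \<open>X = \<Sum>k<r. t k \<cdot> u n \<omega> k \<cdot> (v n \<omega> k)\<^sup>T\<close>, and
  \<open>uh n \<omega> k\<close>, \<open>vh n \<omega> k\<close> are its singular vectors; all random objects live on one probability
  space \<open>M\<close>, with no restriction on the joint law across different \<open>n\<close>.  Deterministic \<open>u\<close>, \<open>v\<close> are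
  the case of no dependence on \<open>\<omega>\<close>.  Orthonormality of \<open>u\<close>, \<open>v\<close> is only required for large \<open>n\<close>,
  because it is impossible as long as \<open>p n < r\<close> or \<open>n < r\<close>.  The last two assumptions are the sign
  convention for the empirical singular vectors.
\<close>

locale spiked_model = prob_space M for M :: "'a measure" +
  fixes p :: "nat \<Rightarrow> nat" and \<gamma> :: real
    and r :: nat and t :: "nat \<Rightarrow> real"
    and u v :: "nat \<Rightarrow> 'a \<Rightarrow> nat \<Rightarrow> real vec"
    and G :: "nat \<Rightarrow> 'a \<Rightarrow> real mat"
    and uh vh :: "nat \<Rightarrow> 'a \<Rightarrow> nat \<Rightarrow> real vec"
  assumes p_at_top: "filterlim p at_top sequentially"
    and aspect_ratio: "(\<lambda>n. real (p n) / real n) \<longlonglongrightarrow> \<gamma>"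
    and t_pos: "\<And>k. k < r \<Longrightarrow> 0 < t k"
    and t_decreasing: "\<And>k l. k < l \<Longrightarrow> l < r \<Longrightarrow> t l < t k"
    and u_orthonormal: "\<forall>\<^sub>F n in sequentially. AE \<omega> in M. orthonormal_family (p n) r (u n \<omega>)"
    and v_orthonormal: "\<forall>\<^sub>F n in sequentially. AE \<omega> in M. orthonormal_family n r (v n \<omega>)"
    and G_carrier: "\<And>n \<omega>. \<omega> \<in> space M \<Longrightarrow> G n \<omega> \<in> carrier_mat (p n) n"
    and G_normal: "\<And>n a b. a < p n \<Longrightarrow> b < n \<Longrightarrow>
      distributed M lborel (\<lambda>\<omega>. G n \<omega> $$ (a, b)) (normal_density 0 (sqrt (1 / real n)))"
    and G_indep: "\<And>n. indep_vars (\<lambda>_. borel) (\<lambda>ab \<omega>. G n \<omega> $$ ab) ({..<p n} \<times> {..<n})"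
    and signal_indep_noise: "\<And>n. indep_set
      (sets (vimage_algebra (space M)
        (\<lambda>\<omega>. (\<lambda>(k, a) \<in> {..<r} \<times> {..<p n}. u n \<omega> k $ a, \<lambda>(k, b) \<in> {..<r} \<times> {..<n}. v n \<omega> k $ b))
        (PiM ({..<r} \<times> {..<p n}) (\<lambda>_. borel :: real measure) \<Otimes>\<^sub>M
         PiM ({..<r} \<times> {..<n}) (\<lambda>_. borel :: real measure))))
      (sets (vimage_algebra (space M)
        (\<lambda>\<omega>. \<lambda>ab \<in> {..<p n} \<times> {..<n}. G n \<omega> $$ ab)
        (PiM ({..<p n} \<times> {..<n}) (\<lambda>_. borel :: real measure))))"
    and empirical_svd: "\<And>n. AE \<omega> in M. \<exists>s.
      is_svd (rank_one_sum (p n) n r t (u n \<omega>) (v n \<omega>) + G n \<omega>) s (uh n \<omega>) (vh n \<omega>)"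
    and left_cosines: "\<And>k. k < r \<Longrightarrow>
      AE \<omega> in M. (\<lambda>n. scalar_prod (uh n \<omega> k) (u n \<omega> k)) \<longlonglongrightarrow> cos_left \<gamma> (t k)"
    and right_cosines: "\<And>k. k < r \<Longrightarrow>
      AE \<omega> in M. (\<lambda>n. scalar_prod (vh n \<omega> k) (v n \<omega> k)) \<longlonglongrightarrow> cos_right \<gamma> (t k)"

text \<open>
  \<open>\<Omega>\<close> and \<open>\<Phi>\<close> are the row and column projections; the column ones are usually written with a
  capital pi, which is reserved syntax.  The limits of the inner products are only required to exist
  almost surely, not to be constant.
\<close>

definition projection_resolution :: "nat \<Rightarrow> nat \<Rightarrow> (nat \<Rightarrow> real mat) \<Rightarrow> bool" where
  "projection_resolution d m P \<longleftrightarrow>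
     (\<forall>i<m. P i \<in> carrier_mat d d \<and> P i = transpose_mat (P i) \<and> P i = P i * P i) \<and>
     (\<forall>i<m. \<forall>i'<m. i \<noteq> i' \<longrightarrow> P i' * P i = 0\<^sub>m d d) \<and>
     mat_sum d d P {..<m} = 1\<^sub>m d"

locale projected_spiked_model = spiked_model M p \<gamma> r t u v G uh vh
  for M :: "'a measure" and p \<gamma> r t u v G uh vh +
  fixes I J :: nat and \<Omega> \<Phi> :: "nat \<Rightarrow> nat \<Rightarrow> real mat"
  assumes \<Omega>_projections: "\<And>n. projection_resolution (p n) I (\<Omega> n)"
    and \<Phi>_projections: "\<And>n. projection_resolution n J (\<Phi> n)"
    and \<Omega>_trace: "\<And>i. i < I \<Longrightarrow> \<exists>l>0. (\<lambda>n. mat_trace (\<Omega> n i) / real (p n)) \<longlonglongrightarrow> l"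
    and \<Phi>_trace: "\<And>j. j < J \<Longrightarrow> \<exists>l>0. (\<lambda>n. mat_trace (\<Phi> n j) / real n) \<longlonglongrightarrow> l"
    and \<Omega>_inner: "\<And>i k l. i < I \<Longrightarrow> k < r \<Longrightarrow> l < r \<Longrightarrow>
      AE \<omega> in M. convergent (\<lambda>n. scalar_prod (\<Omega> n i *\<^sub>v u n \<omega> k) (\<Omega> n i *\<^sub>v u n \<omega> l))"
    and \<Phi>_inner: "\<And>j k l. j < J \<Longrightarrow> k < r \<Longrightarrow> l < r \<Longrightarrow>
      AE \<omega> in M. convergent (\<lambda>n. scalar_prod (\<Phi> n j *\<^sub>v v n \<omega> k) (\<Phi> n j *\<^sub>v v n \<omega> l))"
    and \<Omega>_inner_pos: "\<And>i k. i < I \<Longrightarrow> k < r \<Longrightarrow>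
      AE \<omega> in M. 0 < lim (\<lambda>n. scalar_prod (\<Omega> n i *\<^sub>v u n \<omega> k) (\<Omega> n i *\<^sub>v u n \<omega> k))"
    and \<Phi>_inner_pos: "\<And>j k. j < J \<Longrightarrow> k < r \<Longrightarrow>
      AE \<omega> in M. 0 < lim (\<lambda>n. scalar_prod (\<Phi> n j *\<^sub>v v n \<omega> k) (\<Phi> n j *\<^sub>v v n \<omega> k))"

definition spectral_denoiser ::
    "nat \<Rightarrow> nat \<Rightarrow> nat \<Rightarrow> (nat \<Rightarrow> real vec) \<Rightarrow> (nat \<Rightarrow> real vec) \<Rightarrow> real mat \<Rightarrow> real mat" where
  "spectral_denoiser nr nc m x y B =
     mat_of_cols nr (map x [0..<m]) * B * transpose_mat (mat_of_cols nc (map y [0..<m]))"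

definition weighted_loss :: "real mat \<Rightarrow> real mat \<Rightarrow> real mat \<Rightarrow> real mat \<Rightarrow> real" where
  "weighted_loss W W' Xh X = frob_sq (W * (Xh - X) * transpose_mat W')"

text \<open>
  \<open>loss B n \<omega>\<close> is the loss of the coefficient matrix \<open>B\<close> at index \<open>n\<close>.  The asymptotic loss \<open>L B\<close>
  to be minimized is its almost sure limit, a real number; that it is defined for every
  deterministic \<open>B\<close> is part of the notion.
\<close>

definition minimizes_asymptotic_loss ::
    "'a measure \<Rightarrow> nat \<Rightarrow> (real mat \<Rightarrow> nat \<Rightarrow> 'a \<Rightarrow> real) \<Rightarrow> real mat \<Rightarrow> bool" where
  "minimizes_asymptotic_loss M r loss Bh \<longleftrightarrow>
     (\<exists>L :: real mat \<Rightarrow> real.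
        (\<forall>B \<in> carrier_mat r r. AE \<omega> in M. (\<lambda>n. loss B n \<omega>) \<longlonglongrightarrow> L B) \<and>
        is_arg_min L (\<lambda>B. B \<in> carrier_mat r r) Bh)"

definition localized_denoiser ::
    "nat \<Rightarrow> nat \<Rightarrow> nat \<Rightarrow> (nat \<Rightarrow> real vec) \<Rightarrow> (nat \<Rightarrow> real vec) \<Rightarrow>
     nat \<Rightarrow> nat \<Rightarrow> (nat \<Rightarrow> real mat) \<Rightarrow> (nat \<Rightarrow> real mat) \<Rightarrow> (nat \<Rightarrow> nat \<Rightarrow> real mat) \<Rightarrow> real mat" where
  "localized_denoiser nr nc m x y I J \<Omega> \<Phi> B =
     mat_sum nr nc (\<lambda>(i, j). \<Omega> i * spectral_denoiser nr nc m x y (B i j) * \<Phi> j)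
       ({..<I} \<times> {..<J})"

definition shrinkage_denoiser ::
    "real \<Rightarrow> nat \<Rightarrow> nat \<Rightarrow> nat \<Rightarrow> (nat \<Rightarrow> real) \<Rightarrow> (nat \<Rightarrow> real vec) \<Rightarrow> (nat \<Rightarrow> real vec) \<Rightarrow> real mat" where
  "shrinkage_denoiser \<gamma> nr nc m t x y =
     rank_one_sum nr nc m (\<lambda>k. t k * cos_left \<gamma> (t k) * cos_right \<gamma> (t k)) x y"

end

theory Submission
  imports Defs
begin

text \<open>
  The localized denoiser and the shrinker belong to one family. Choosing a coefficient matrix
  \<open>B i j\<close> for every block \<open>(i, j)\<close> gives a localized denoiser, and the shrinker is the member for
  which all blocks use the same diagonal matrix \<open>D\<close> of the singular values \<open>t k\<close> times the limiting
  left and right cosines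
  (\<open>localized_denoiser_const\<close>, \<open>shrinkage_denoiser_eq_spectral_denoiser\<close>).

  Because the projections resolve the identity on both sides, the matrices
  \<open>\<Omega> i * A * \<Phi> j\<close> in different blocks are orthogonal for the Frobenius inner product. By
  Pythagoras the total error of a member of the family is the sum over the blocks of the weighted
  losses of the coefficient matrices \<open>B i j\<close> (\<open>frob_sq_localized_denoiser_error\<close>). The blocks
  therefore do not interact: almost surely the total error converges to the sum of the asymptotic
  losses \<open>L i j (B i j)\<close>. By definition \<open>Bh i j\<close> minimizes \<open>L i j\<close>, so
  \<open>L i j (Bh i j) \<le> L i j D\<close>, and adding these inequalities gives the claim.

  That the limits \<open>L i j\<close> exist, at \<open>Bh i j\<close> and at \<open>D\<close> alike, is part of what it means for
  \<open>Bh i j\<close> to minimize the asymptotic loss; the almost sure statements are combined over the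
  finitely many blocks.
\<close>

section \<open>Orthogonality for the Frobenius inner product\<close>

definition frob_inner :: "real mat \<Rightarrow> real mat \<Rightarrow> real" where
  "frob_inner A B = (\<Sum>a<dim_row A. \<Sum>b<dim_col A. A $$ (a, b) * B $$ (a, b))"

lemma frob_inner_self: "frob_inner A A = frob_sq A"
  by (simp add: frob_inner_def frob_sq_def power2_eq_square)

text \<open>The inner product is the trace of \<open>A\<^sup>T * B\<close>.\<close>

lemma frob_inner_eq_0_if_transpose_mult:
  assumes A: "A \<in> carrier_mat nr nc" and B: "B \<in> carrier_mat nr nc"
    and AB: "transpose_mat A * B = 0\<^sub>m nc nc"
  shows "frob_inner A B = 0"
proof -
  have "(\<Sum>a<nr. A $$ (a, b) * B $$ (a, b)) = 0" if b: "b < nc" for b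
  proof -
    have "(transpose_mat A * B) $$ (b, b) = (\<Sum>a<nr. A $$ (a, b) * B $$ (a, b))"
      using A B b by (auto simp: scalar_prod_def atLeast0LessThan)
    then show ?thesis
      using AB b by simp
  qed
  then have "(\<Sum>b<nc. \<Sum>a<nr. A $$ (a, b) * B $$ (a, b)) = 0"
    by simp
  then show ?thesis
    using A by (subst (asm) sum.swap) (simp add: frob_inner_def)
qed

text \<open>The inner product is also the trace of \<open>A * B\<^sup>T\<close>.\<close>

lemma frob_inner_eq_0_if_mult_transpose:
  assumes A: "A \<in> carrier_mat nr nc" and B: "B \<in> carrier_mat nr nc"
    and AB: "A * transpose_mat B = 0\<^sub>m nr nr"
  shows "frob_inner A B = 0"
proof -
  have "(\<Sum>b<nc. A $$ (a, b) * B $$ (a, b)) = 0" if a: "a < nr" for a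
  proof -
    have "(A * transpose_mat B) $$ (a, a) = (\<Sum>b<nc. A $$ (a, b) * B $$ (a, b))"
      using A B a by (auto simp: scalar_prod_def atLeast0LessThan)
    then show ?thesis
      using AB a by simp
  qed
  then show ?thesis
    using A by (simp add: frob_inner_def)
qed

lemma frob_sq_mat_sum_orthogonal:
  assumes fin: "finite K"
    and A: "\<And>k. k \<in> K \<Longrightarrow> A k \<in> carrier_mat nr nc"
    and orth: "\<And>k l. k \<in> K \<Longrightarrow> l \<in> K \<Longrightarrow> k \<noteq> l \<Longrightarrow> frob_inner (A k) (A l) = 0"
  shows "frob_sq (mat_sum nr nc A K) = (\<Sum>k\<in>K. frob_sq (A k))"
proof -
  have "frob_sq (mat_sum nr nc A K)
      = (\<Sum>a<nr. \<Sum>b<nc. \<Sum>k\<in>K. \<Sum>l\<in>K. A k $$ (a, b) * A l $$ (a, b))"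
    by (simp add: frob_sq_def mat_sum_def power2_eq_square sum_product)
  also have "\<dots> = (\<Sum>a<nr. \<Sum>k\<in>K. \<Sum>b<nc. \<Sum>l\<in>K. A k $$ (a, b) * A l $$ (a, b))"
    by (intro sum.cong refl sum.swap)
  also have "\<dots> = (\<Sum>k\<in>K. \<Sum>a<nr. \<Sum>b<nc. \<Sum>l\<in>K. A k $$ (a, b) * A l $$ (a, b))"
    by (rule sum.swap)
  also have "\<dots> = (\<Sum>k\<in>K. \<Sum>a<nr. \<Sum>l\<in>K. \<Sum>b<nc. A k $$ (a, b) * A l $$ (a, b))"
    by (intro sum.cong refl sum.swap)
  also have "\<dots> = (\<Sum>k\<in>K. \<Sum>l\<in>K. \<Sum>a<nr. \<Sum>b<nc. A k $$ (a, b) * A l $$ (a, b))"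
    by (intro sum.cong refl sum.swap)
  also have "\<dots> = (\<Sum>k\<in>K. \<Sum>l\<in>K. frob_inner (A k) (A l))"
    using A by (intro sum.cong refl) (simp add: frob_inner_def carrier_matD[OF A])
  also have "\<dots> = (\<Sum>k\<in>K. \<Sum>l\<in>K. if l = k then frob_sq (A k) else 0)"
    using orth by (intro sum.cong refl) (auto simp: frob_inner_self)
  also have "\<dots> = (\<Sum>k\<in>K. frob_sq (A k))"
    using fin by simp
  finally show ?thesis .
qed

section \<open>Blocks cut out by resolutions of the identity\<close>

lemma projection_resolutionD:
  assumes "projection_resolution d m P" and "i < m"
  shows projection_resolution_carrier: "P i \<in> carrier_mat d d"
    and projection_resolution_transpose: "transpose_mat (P i) = P i"
    and projection_resolution_orthogonal:
      "\<And>i'. i' < m \<Longrightarrow> i' \<noteq> i \<Longrightarrow> P i * P i' = 0\<^sub>m d d"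
proof -
  show "P i \<in> carrier_mat d d"
    using assms unfolding projection_resolution_def by blast
  have "P i = transpose_mat (P i)"
    using assms unfolding projection_resolution_def by blast
  then show "transpose_mat (P i) = P i"
    by (rule sym)
  show "P i * P i' = 0\<^sub>m d d" if "i' < m" "i' \<noteq> i" for i'
    using assms that unfolding projection_resolution_def by blast
qed

lemma projection_resolution_sum_entries:
  assumes "projection_resolution d m P" and "a < d" and "b < d"
  shows "(\<Sum>i<m. P i $$ (a, b)) = (if a = b then 1 else 0)"
proof -
  have "mat_sum d d P {..<m} $$ (a, b) = 1\<^sub>m d $$ (a, b)"
    using assms(1) by (simp add: projection_resolution_def)
  then show ?thesis
    using assms(2,3) by (simp add: mat_sum_def)
qed

lemma triple_mult_entry:
  fixes P A Q :: "real mat"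
  assumes "P \<in> carrier_mat nr nr" and "A \<in> carrier_mat nr nc" and "Q \<in> carrier_mat nc nc"
    and "a < nr" and "b < nc"
  shows "(P * A * Q) $$ (a, b) = (\<Sum>c<nr. \<Sum>d<nc. P $$ (a, c) * A $$ (c, d) * Q $$ (d, b))"
  using assms by (simp add: scalar_prod_def atLeast0LessThan sum_distrib_left mult.assoc)

lemma mat_sum_blocks:
  assumes \<Omega>: "projection_resolution nr I \<Omega>" and \<Phi>: "projection_resolution nc J \<Phi>"
    and A: "A \<in> carrier_mat nr nc"
  shows "mat_sum nr nc (\<lambda>(i, j). \<Omega> i * A * \<Phi> j) ({..<I} \<times> {..<J}) = A"
proof (rule eq_matI)
  fix a b assume "a < dim_row A" and "b < dim_col A"
  then have ab: "a < nr" "b < nc"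
    using A by auto
  have "(\<Sum>i<I. \<Sum>j<J. (\<Omega> i * A * \<Phi> j) $$ (a, b))
      = (\<Sum>i<I. \<Sum>j<J. \<Sum>c<nr. \<Sum>d<nc. \<Omega> i $$ (a, c) * A $$ (c, d) * \<Phi> j $$ (d, b))"
    using ab A by (intro sum.cong refl triple_mult_entry)
      (auto intro: projection_resolution_carrier[OF \<Omega>] projection_resolution_carrier[OF \<Phi>])
  also have "\<dots> = (\<Sum>i<I. \<Sum>c<nr. \<Sum>j<J. \<Sum>d<nc. \<Omega> i $$ (a, c) * A $$ (c, d) * \<Phi> j $$ (d, b))"
    by (intro sum.cong refl sum.swap)
  also have "\<dots> = (\<Sum>c<nr. \<Sum>i<I. \<Sum>j<J. \<Sum>d<nc. \<Omega> i $$ (a, c) * A $$ (c, d) * \<Phi> j $$ (d, b))"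
    by (rule sum.swap)
  also have "\<dots> = (\<Sum>c<nr. \<Sum>i<I. \<Sum>d<nc. \<Sum>j<J. \<Omega> i $$ (a, c) * A $$ (c, d) * \<Phi> j $$ (d, b))"
    by (intro sum.cong refl sum.swap)
  also have "\<dots> = (\<Sum>c<nr. \<Sum>d<nc. \<Sum>i<I. \<Sum>j<J. \<Omega> i $$ (a, c) * A $$ (c, d) * \<Phi> j $$ (d, b))"
    by (intro sum.cong refl sum.swap)
  also have "\<dots> = (\<Sum>c<nr. \<Sum>d<nc. A $$ (c, d) * ((\<Sum>i<I. \<Omega> i $$ (a, c)) * (\<Sum>j<J. \<Phi> j $$ (d, b))))"
    unfolding sum_product by (simp add: sum_distrib_left mult_ac)
  also have "\<dots> = (\<Sum>c<nr. \<Sum>d<nc. if d = b then if c = a then A $$ (a, b) else 0 else 0)"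
    using ab by (intro sum.cong refl)
      (auto simp: projection_resolution_sum_entries[OF \<Omega>] projection_resolution_sum_entries[OF \<Phi>])
  also have "\<dots> = A $$ (a, b)"
    using ab by simp
  finally show "mat_sum nr nc (\<lambda>(i, j). \<Omega> i * A * \<Phi> j) ({..<I} \<times> {..<J}) $$ (a, b) = A $$ (a, b)"
    using ab by (simp add: mat_sum_def sum.cartesian_product case_prod_beta)
qed (use A in \<open>auto simp: mat_sum_def\<close>)

text \<open>
  Two distinct blocks differ in the row index or in the column index. Since projections are
  symmetric, the product \<open>(\<Omega> i * A * \<Phi> j)\<^sup>T * (\<Omega> i' * A' * \<Phi> j')\<close> contains the factor \<open>\<Omega> i * \<Omega> i'\<close>,
  which is \<open>0\<close> in the first case, and \<open>(\<Omega> i * A * \<Phi> j) * (\<Omega> i' * A' * \<Phi> j')\<^sup>T\<close> contains the factor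
  \<open>\<Phi> j * \<Phi> j'\<close>, which is \<open>0\<close> in the second case. Either way a trace of \<open>0\<close> is left.
\<close>

lemma frob_inner_blocks:
  assumes \<Omega>: "projection_resolution nr I \<Omega>" and \<Phi>: "projection_resolution nc J \<Phi>"
    and A: "A \<in> carrier_mat nr nc" and A': "A' \<in> carrier_mat nr nc"
    and i: "i < I" and i': "i' < I" and j: "j < J" and j': "j' < J"
    and neq: "(i, j) \<noteq> (i', j')"
  shows "frob_inner (\<Omega> i * A * \<Phi> j) (\<Omega> i' * A' * \<Phi> j') = 0"
proof -
  note \<Omega>i = projection_resolution_carrier[OF \<Omega> i] and \<Omega>i' = projection_resolution_carrier[OF \<Omega> i']
    and \<Phi>j = projection_resolution_carrier[OF \<Phi> j] and \<Phi>j' = projection_resolution_carrier[OF \<Phi> j']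
  note \<Omega>A = mult_carrier_mat[OF \<Omega>i A] and \<Omega>A' = mult_carrier_mat[OF \<Omega>i' A']
    and A\<Phi>' = mult_carrier_mat[OF A' \<Phi>j']
  have At: "transpose_mat A \<in> carrier_mat nc nr"
    using A by simp
  have \<Omega>At': "transpose_mat (\<Omega> i' * A') \<in> carrier_mat nc nr"
    using \<Omega>A' by simp
  note C = mult_carrier_mat[OF \<Omega>A \<Phi>j] and D = mult_carrier_mat[OF \<Omega>A' \<Phi>j']
  show ?thesis
  proof (cases "i = i'")
    case False
    then have 0: "\<Omega> i * \<Omega> i' = 0\<^sub>m nr nr"
      using projection_resolution_orthogonal[OF \<Omega> i i'] by simp
    have "transpose_mat (\<Omega> i * A * \<Phi> j) = \<Phi> j * (transpose_mat A * \<Omega> i)"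
      by (simp only: transpose_mult[OF \<Omega>A \<Phi>j] transpose_mult[OF \<Omega>i A]
          projection_resolution_transpose[OF \<Omega> i] projection_resolution_transpose[OF \<Phi> j])
    also have "\<dots> = \<Phi> j * transpose_mat A * \<Omega> i"
      by (rule assoc_mult_mat[OF \<Phi>j At \<Omega>i, symmetric])
    finally have "transpose_mat (\<Omega> i * A * \<Phi> j) * (\<Omega> i' * A' * \<Phi> j')
        = \<Phi> j * transpose_mat A * \<Omega> i * (\<Omega> i' * (A' * \<Phi> j'))"
      by (simp only: assoc_mult_mat[OF \<Omega>i' A' \<Phi>j'])
    also have "\<dots> = \<Phi> j * transpose_mat A * (\<Omega> i * \<Omega> i' * (A' * \<Phi> j'))"
      by (simp only: assoc_mult_mat[OF mult_carrier_mat[OF \<Phi>j At] \<Omega>i mult_carrier_mat[OF \<Omega>i' A\<Phi>']]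
          assoc_mult_mat[OF \<Omega>i \<Omega>i' A\<Phi>'])
    also have "\<dots> = 0\<^sub>m nc nc"
      by (simp only: 0 left_mult_zero_mat[OF A\<Phi>'] right_mult_zero_mat[OF mult_carrier_mat[OF \<Phi>j At]])
    finally show ?thesis
      by (rule frob_inner_eq_0_if_transpose_mult[OF C D])
  next
    case True
    then have 0: "\<Phi> j * \<Phi> j' = 0\<^sub>m nc nc"
      using projection_resolution_orthogonal[OF \<Phi> j j'] neq by simp
    have "\<Omega> i * A * \<Phi> j * transpose_mat (\<Omega> i' * A' * \<Phi> j')
        = \<Omega> i * A * \<Phi> j * (\<Phi> j' * transpose_mat (\<Omega> i' * A'))"
      by (simp only: transpose_mult[OF \<Omega>A' \<Phi>j'] projection_resolution_transpose[OF \<Phi> j'])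
    also have "\<dots> = \<Omega> i * A * (\<Phi> j * \<Phi> j' * transpose_mat (\<Omega> i' * A'))"
      by (simp only: assoc_mult_mat[OF \<Omega>A \<Phi>j mult_carrier_mat[OF \<Phi>j' \<Omega>At']]
          assoc_mult_mat[OF \<Phi>j \<Phi>j' \<Omega>At'])
    also have "\<dots> = 0\<^sub>m nr nr"
      by (simp only: 0 left_mult_zero_mat[OF \<Omega>At'] right_mult_zero_mat[OF \<Omega>A])
    finally show ?thesis
      by (rule frob_inner_eq_0_if_mult_transpose[OF C D])
  qed
qed

section \<open>The family of localized denoisers\<close>

lemma spectral_denoiser_carrier: "spectral_denoiser nr nc m x y B \<in> carrier_mat nr nc"
  by (rule carrier_matI)
    (simp_all only: spectral_denoiser_def index_mult_mat index_transpose_mat mat_of_cols_carrier)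

lemma localized_denoiser_const:
  assumes "projection_resolution nr I \<Omega>" and "projection_resolution nc J \<Phi>"
  shows "localized_denoiser nr nc m x y I J \<Omega> \<Phi> (\<lambda>_ _. B) = spectral_denoiser nr nc m x y B"
  by (simp only: localized_denoiser_def mat_sum_blocks[OF assms spectral_denoiser_carrier])

definition shrinkage_coefficients :: "real \<Rightarrow> nat \<Rightarrow> (nat \<Rightarrow> real) \<Rightarrow> real mat" where
  "shrinkage_coefficients \<gamma> m t =
     mat m m (\<lambda>(k, l). if k = l then t k * cos_left \<gamma> (t k) * cos_right \<gamma> (t k) else 0)"

lemma shrinkage_denoiser_eq_spectral_denoiser:
  "shrinkage_denoiser \<gamma> nr nc m t x y
     = spectral_denoiser nr nc m x y (shrinkage_coefficients \<gamma> m t)"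
proof (rule eq_matI)
  let ?B = "shrinkage_coefficients \<gamma> m t"
  let ?s = "\<lambda>k. t k * cos_left \<gamma> (t k) * cos_right \<gamma> (t k)"
  fix a b assume "a < dim_row (spectral_denoiser nr nc m x y ?B)"
    and "b < dim_col (spectral_denoiser nr nc m x y ?B)"
  then have ab: "a < nr" "b < nc"
    using spectral_denoiser_carrier[of nr nc m x y ?B] by auto
  have column: "(\<Sum>k<m. x k $ a * ?B $$ (k, l)) = x l $ a * ?s l" if l: "l < m" for l
  proof -
    have "(\<Sum>k<m. x k $ a * ?B $$ (k, l)) = (\<Sum>k<m. if k = l then x l $ a * ?s l else 0)"
      using l by (intro sum.cong refl) (simp add: shrinkage_coefficients_def)
    then show ?thesis
      using l by simp
  qed
  have B: "?B \<in> carrier_mat m m"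
    by (simp add: shrinkage_coefficients_def)
  have "spectral_denoiser nr nc m x y ?B $$ (a, b)
      = (\<Sum>l<m. (\<Sum>k<m. x k $ a * ?B $$ (k, l)) * y l $ b)"
    using ab B by (simp add: spectral_denoiser_def scalar_prod_def mat_of_cols_def
        atLeast0LessThan)
  also have "\<dots> = (\<Sum>l<m. x l $ a * ?s l * y l $ b)"
    by (intro sum.cong refl) (simp only: column lessThan_iff)
  also have "\<dots> = (\<Sum>l<m. ?s l * x l $ a * y l $ b)"
    by (simp only: mult.commute)
  finally show "shrinkage_denoiser \<gamma> nr nc m t x y $$ (a, b)
      = spectral_denoiser nr nc m x y ?B $$ (a, b)"
    using ab by (simp add: shrinkage_denoiser_def rank_one_sum_def)
qed (simp_all only: shrinkage_denoiser_def rank_one_sum_def dim_row_mat dim_col_mat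
    carrier_matD[OF spectral_denoiser_carrier])

text \<open>
  Cutting \<open>X\<close> itself into blocks turns the error into a sum of the block matrices
  \<open>\<Omega> i * (Xh i j - X) * \<Phi> j\<close>, to which Pythagoras applies.
\<close>

lemma frob_sq_localized_denoiser_error:
  assumes \<Omega>: "projection_resolution nr I \<Omega>" and \<Phi>: "projection_resolution nc J \<Phi>"
    and X: "X \<in> carrier_mat nr nc"
  shows "frob_sq (localized_denoiser nr nc m x y I J \<Omega> \<Phi> B - X)
    = (\<Sum>(i, j)\<in>{..<I} \<times> {..<J}.
        weighted_loss (\<Omega> i) (\<Phi> j) (spectral_denoiser nr nc m x y (B i j)) X)"
proof -
  let ?K = "{..<I} \<times> {..<J}"
  define S where "S i j = spectral_denoiser nr nc m x y (B i j)" for i j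
  have S: "S i j \<in> carrier_mat nr nc" for i j
    by (simp add: S_def spectral_denoiser_carrier)
  have SX: "S i j - X \<in> carrier_mat nr nc" for i j
    using X by (rule minus_carrier_mat)
  note \<Omega>c = projection_resolution_carrier[OF \<Omega>] and \<Phi>c = projection_resolution_carrier[OF \<Phi>]
  have block_carrier: "\<Omega> i * A * \<Phi> j \<in> carrier_mat nr nc"
    if "i < I" "j < J" "A \<in> carrier_mat nr nc" for i j A
    by (rule mult_carrier_mat[OF mult_carrier_mat[OF \<Omega>c[OF that(1)] that(3)] \<Phi>c[OF that(2)]])
  have distrib: "\<Omega> i * (S i j - X) * \<Phi> j = \<Omega> i * S i j * \<Phi> j - \<Omega> i * X * \<Phi> j"
    if ij: "i < I" "j < J" for i j
    by (simp only: mult_minus_distrib_mat[OF \<Omega>c[OF ij(1)] S X]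
        minus_mult_distrib_mat[OF mult_carrier_mat[OF \<Omega>c[OF ij(1)] S]
          mult_carrier_mat[OF \<Omega>c[OF ij(1)] X] \<Phi>c[OF ij(2)]])
  have "localized_denoiser nr nc m x y I J \<Omega> \<Phi> B - X
      = mat_sum nr nc (\<lambda>(i, j). \<Omega> i * S i j * \<Phi> j) ?K - mat_sum nr nc (\<lambda>(i, j). \<Omega> i * X * \<Phi> j) ?K"
    by (simp only: mat_sum_blocks[OF \<Omega> \<Phi> X] localized_denoiser_def S_def)
  also have "\<dots> = mat_sum nr nc (\<lambda>(i, j). \<Omega> i * (S i j - X) * \<Phi> j) ?K"
  proof (rule eq_matI)
    fix a b assume "a < dim_row (mat_sum nr nc (\<lambda>(i, j). \<Omega> i * (S i j - X) * \<Phi> j) ?K)"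
      and "b < dim_col (mat_sum nr nc (\<lambda>(i, j). \<Omega> i * (S i j - X) * \<Phi> j) ?K)"
    then have ab: "a < nr" "b < nc"
      by (simp_all add: mat_sum_def)
    have "(\<Omega> i * (S i j - X) * \<Phi> j) $$ (a, b)
        = (\<Omega> i * S i j * \<Phi> j) $$ (a, b) - (\<Omega> i * X * \<Phi> j) $$ (a, b)" if "i < I" "j < J" for i j
      unfolding distrib[OF that] using ab carrier_matD[OF block_carrier[OF that X]]
      by (intro index_minus_mat) simp_all
    then have "(\<Sum>(i, j)\<in>?K. (\<Omega> i * (S i j - X) * \<Phi> j) $$ (a, b))
        = (\<Sum>(i, j)\<in>?K. (\<Omega> i * S i j * \<Phi> j) $$ (a, b) - (\<Omega> i * X * \<Phi> j) $$ (a, b))"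
      by (intro sum.cong refl) (clarsimp simp only: lessThan_iff)
    also have "\<dots> = (\<Sum>(i, j)\<in>?K. (\<Omega> i * S i j * \<Phi> j) $$ (a, b))
        - (\<Sum>(i, j)\<in>?K. (\<Omega> i * X * \<Phi> j) $$ (a, b))"
      by (simp add: case_prod_beta sum_subtractf del: index_mult_mat)
    finally show "(mat_sum nr nc (\<lambda>(i, j). \<Omega> i * S i j * \<Phi> j) ?K
          - mat_sum nr nc (\<lambda>(i, j). \<Omega> i * X * \<Phi> j) ?K) $$ (a, b)
        = mat_sum nr nc (\<lambda>(i, j). \<Omega> i * (S i j - X) * \<Phi> j) ?K $$ (a, b)"
      using ab by (simp add: mat_sum_def case_prod_beta del: index_mult_mat)
  qed (simp_all add: mat_sum_def)
  finally have "frob_sq (localized_denoiser nr nc m x y I J \<Omega> \<Phi> B - X)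
      = frob_sq (mat_sum nr nc (\<lambda>(i, j). \<Omega> i * (S i j - X) * \<Phi> j) ?K)"
    by simp
  also have "\<dots> = (\<Sum>ij\<in>?K. frob_sq ((\<lambda>(i, j). \<Omega> i * (S i j - X) * \<Phi> j) ij))"
  proof (rule frob_sq_mat_sum_orthogonal)
    show "(\<lambda>(i, j). \<Omega> i * (S i j - X) * \<Phi> j) ij \<in> carrier_mat nr nc" if "ij \<in> ?K" for ij
      using that by (cases ij) (simp add: block_carrier SX)
    show "frob_inner ((\<lambda>(i, j). \<Omega> i * (S i j - X) * \<Phi> j) k) ((\<lambda>(i, j). \<Omega> i * (S i j - X) * \<Phi> j) l) = 0"
      if "k \<in> ?K" "l \<in> ?K" "k \<noteq> l" for k l
      using that frob_inner_blocks[OF \<Omega> \<Phi> SX SX] by (cases k; cases l) simp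
  qed simp
  also have "\<dots> = (\<Sum>(i, j)\<in>?K. weighted_loss (\<Omega> i) (\<Phi> j) (S i j) X)"
    by (intro sum.cong refl)
      (clarsimp simp only: weighted_loss_def projection_resolution_transpose[OF \<Phi>] lessThan_iff)
  finally show ?thesis
    by (simp add: S_def)
qed

section \<open>Comparison of the limits\<close>

theorem theorem5p1:
  fixes M :: "'a measure"
    and p :: "nat \<Rightarrow> nat" and \<gamma> :: real and r :: nat and t :: "nat \<Rightarrow> real"
    and u v :: "nat \<Rightarrow> 'a \<Rightarrow> nat \<Rightarrow> real vec" and G :: "nat \<Rightarrow> 'a \<Rightarrow> real mat"
    and uh vh :: "nat \<Rightarrow> 'a \<Rightarrow> nat \<Rightarrow> real vec"
    and I J :: nat and \<Omega> \<Phi> :: "nat \<Rightarrow> nat \<Rightarrow> real mat"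
    and Bh :: "nat \<Rightarrow> nat \<Rightarrow> real mat"
    and X Xloc Xshr :: "nat \<Rightarrow> 'a \<Rightarrow> real mat"
  assumes model: "projected_spiked_model M p \<gamma> r t u v G uh vh I J \<Omega> \<Phi>"
    and X: "\<And>n \<omega>. X n \<omega> = rank_one_sum (p n) n r t (u n \<omega>) (v n \<omega>)"
    and optimal: "\<And>i j. i < I \<Longrightarrow> j < J \<Longrightarrow>
      minimizes_asymptotic_loss M r
        (\<lambda>B n \<omega>. weighted_loss (\<Omega> n i) (\<Phi> n j)
           (spectral_denoiser (p n) n r (uh n \<omega>) (vh n \<omega>) B) (X n \<omega>))
        (Bh i j)"
    and Xloc: "\<And>n \<omega>. Xloc n \<omega> =
      localized_denoiser (p n) n r (uh n \<omega>) (vh n \<omega>) I J (\<Omega> n) (\<Phi> n) Bh"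
    and Xshr: "\<And>n \<omega>. Xshr n \<omega> = shrinkage_denoiser \<gamma> (p n) n r t (uh n \<omega>) (vh n \<omega>)"
  shows "AE \<omega> in M.
      convergent (\<lambda>n. frob_sq (Xloc n \<omega> - X n \<omega>)) \<and>
      convergent (\<lambda>n. frob_sq (Xshr n \<omega> - X n \<omega>)) \<and>
      lim (\<lambda>n. frob_sq (Xloc n \<omega> - X n \<omega>)) \<le> lim (\<lambda>n. frob_sq (Xshr n \<omega> - X n \<omega>))"
proof -
  interpret projected_spiked_model M p \<gamma> r t u v G uh vh I J \<Omega> \<Phi>
    by (rule model)
  let ?K = "{..<I} \<times> {..<J}"
  let ?D = "shrinkage_coefficients \<gamma> r t"
  let ?loss = "\<lambda>i j B n \<omega>. weighted_loss (\<Omega> n i) (\<Phi> n j)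
    (spectral_denoiser (p n) n r (uh n \<omega>) (vh n \<omega>) B) (X n \<omega>)"
  have X_carrier: "X n \<omega> \<in> carrier_mat (p n) n" for n \<omega>
    by (simp add: X rank_one_sum_def)
  have loc: "frob_sq (Xloc n \<omega> - X n \<omega>) = (\<Sum>(i, j)\<in>?K. ?loss i j (Bh i j) n \<omega>)" for n \<omega>
    unfolding Xloc
    by (rule frob_sq_localized_denoiser_error[OF \<Omega>_projections \<Phi>_projections X_carrier])
  have Xshr_const: "Xshr n \<omega>
      = localized_denoiser (p n) n r (uh n \<omega>) (vh n \<omega>) I J (\<Omega> n) (\<Phi> n) (\<lambda>_ _. ?D)" for n \<omega>
    by (simp only: Xshr shrinkage_denoiser_eq_spectral_denoiser
        localized_denoiser_const[OF \<Omega>_projections \<Phi>_projections])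
  have shr: "frob_sq (Xshr n \<omega> - X n \<omega>) = (\<Sum>(i, j)\<in>?K. ?loss i j ?D n \<omega>)" for n \<omega>
    unfolding Xshr_const
    by (rule frob_sq_localized_denoiser_error[OF \<Omega>_projections \<Phi>_projections X_carrier])
  \<comment> \<open>A limit functional is chosen for each block, so that the limits can be summed over blocks.\<close>
  define is_loss where "is_loss i j L \<longleftrightarrow>
      (\<forall>B \<in> carrier_mat r r. AE \<omega> in M. (\<lambda>n. ?loss i j B n \<omega>) \<longlonglongrightarrow> L B) \<and>
      is_arg_min L (\<lambda>B. B \<in> carrier_mat r r) (Bh i j)" for i j and L :: "real mat \<Rightarrow> real"
  define L where "L i j = (SOME L. is_loss i j L)" for i j
  have is_loss: "is_loss i j (L i j)" if "i < I" "j < J" for i j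
  proof -
    have "\<exists>L. is_loss i j L"
      using optimal[OF that] unfolding minimizes_asymptotic_loss_def is_loss_def .
    then show ?thesis
      unfolding L_def by (rule someI_ex)
  qed
  have L: "AE \<omega> in M. (\<lambda>n. ?loss i j B n \<omega>) \<longlonglongrightarrow> L i j B"
    if "i < I" "j < J" "B \<in> carrier_mat r r" for i j B
    using is_loss[OF that(1,2)] that(3) unfolding is_loss_def by blast
  have min: "is_arg_min (L i j) (\<lambda>B. B \<in> carrier_mat r r) (Bh i j)" if "i < I" "j < J" for i j
    using is_loss[OF that] unfolding is_loss_def by blast
  have D: "?D \<in> carrier_mat r r"
    by (simp add: shrinkage_coefficients_def)
  have Bh: "Bh i j \<in> carrier_mat r r" and le: "L i j (Bh i j) \<le> L i j ?D"
    if "i < I" "j < J" for i j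
    using min[OF that] D by (auto simp: is_arg_min_def not_less)
  have "AE \<omega> in M. \<forall>(i, j)\<in>?K. (\<lambda>n. ?loss i j (Bh i j) n \<omega>) \<longlonglongrightarrow> L i j (Bh i j)"
    using L Bh by (intro AE_finite_allI) auto
  moreover have "AE \<omega> in M. \<forall>(i, j)\<in>?K. (\<lambda>n. ?loss i j ?D n \<omega>) \<longlonglongrightarrow> L i j ?D"
    using L D by (intro AE_finite_allI) auto
  ultimately show ?thesis
  proof eventually_elim
    case (elim \<omega>)
    have "(\<lambda>n. frob_sq (Xloc n \<omega> - X n \<omega>)) \<longlonglongrightarrow> (\<Sum>(i, j)\<in>?K. L i j (Bh i j))"
      unfolding loc using elim(1) by (auto intro!: tendsto_sum simp: case_prod_beta)
    moreover have "(\<lambda>n. frob_sq (Xshr n \<omega> - X n \<omega>)) \<longlonglongrightarrow> (\<Sum>(i, j)\<in>?K. L i j ?D)"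
      unfolding shr using elim(2) by (auto intro!: tendsto_sum simp: case_prod_beta)
    moreover have "(\<Sum>(i, j)\<in>?K. L i j (Bh i j)) \<le> (\<Sum>(i, j)\<in>?K. L i j ?D)"
      using le by (intro sum_mono) auto
    ultimately show ?case
      by (auto simp: convergent_def limI)
  qed
qed

end
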